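(* Let $\Gamma=(V,\rho,a,B)$ be a finite network, let $\lambda\in\Lambda$ be fixed, and write $\rho_{xy}=\rho_{xy}^{(\lambda)}$, $\mathcal{P}=\mathcal{P}(\lambda)$. Assume that, for some $\epsilon>0$, $$\inf_{xy\in E}\frac{\operatorname{Re}\rho_{xy}}{|\rho_{xy}|}\ge\epsilon .$$ Then $$|\mathcal{P}|\le\frac{1}{\epsilon^{2}}\sum_{x\sim a}|\rho_{xa}|.$$ The same conclusion holds if, instead of the condition $\inf_{xy\in E}\frac{\operatorname{Re}\rho_{xy}}{|\rho_{xy}|}\ge\epsilon$, one assumes that $$\inf_{xy\in E}\frac{\operatorname{Im}\rho_{xy}}{|\rho_{xy}|}\ge\epsilon\qquad\text{or}\qquad \inf_{xy\in E}\frac{-\operatorname{Im}\rho_{xy}}{|\rho_{xy}|}\ge\epsilon .$$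
   Context: Let $(V,E)$ be a finite connected undirected graph with $|V|\ge2$, edges being unordered pairs $xy$ of vertices; $x\sim y$ means $xy\in E$. Each edge $xy\in E$ carries real numbers $R_{xy},L_{xy},D_{xy}\in[0,+\infty)$ with $R_{xy}+L_{xy}+D_{xy}>0$. For $\lambda\in\mathbb{C}\setminus\{0\}$ put $z_{xy}^{(\lambda)}=R_{xy}+L_{xy}\lambda+\frac{D_{xy}}{\lambda}$ (impedance) and $\rho_{xy}^{(\lambda)}=1/z_{xy}^{(\lambda)}$ (admittance); set $\rho_{xy}^{(\lambda)}=0$ if $x\not\sim y$. Let $\Lambda$ be the set of those $\lambda\in\mathbb{C}\setminus\{0\}$ with $L_{xy}\lambda^2+R_{xy}\lambda+D_{xy}\ne0$ for all $xy\in E$ (so that $\rho_{xy}^{(\lambda)}\in\mathbb{C}\setminus\{0\}$ for all edges). Fix $a\in V$ and a non-empty $B\subset V$ with $a\notin B$; put $B_0=B\cup\{a\}$. The structure $\Gamma=(V,\rho,a,B)$ is called a finite network. For $\lambda\in\Lambda$ and $f:V\to\mathbb{C}$ put $\Delta_\rho f(x)=\sum_{y\in V}(f(y)-f(x))\rho_{xy}^{(\lambda)}$. The Dirichlet problem for $v:V\to\mathbb{C}$ is: $\Delta_\rho v(x)=0$ for $x\in V\setminus B_0$, $v(x)=0$ for $x\in B$, $v(a)=1$. The effective admittance of $\Gamma$ is $\mathcal{P}(\lambda)=\sum_{x\in V}(1-v(x))\rho_{xa}^{(\lambda)}$ where $v$ is any solution of the Dirichlet problem (the value does not depend on the choice of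 the solution); if there is no solution, $\mathcal{P}(\lambda)=\infty$. *)

theory Defs
  imports "HOL-Analysis.Analysis"
begin

text \<open>
  An edge is the unordered pair \<open>{x, y}\<close>, so functions of edges are automatically symmetric
  in the endpoints. An edge \<open>{x, x}\<close> is not excluded: it contributes nothing to the Laplacian
  or to the effective admittance, and loopless graphs are a special case.
\<close>

record 'v network =
  verts :: "'v set"
  edges :: "'v set set"
  resistance :: "'v set \<Rightarrow> real"
  inductance :: "'v set \<Rightarrow> real"
  elastance :: "'v set \<Rightarrow> real"
  source :: 'v
  ground :: "'v set"

definition adj :: "('v, 'm) network_scheme \<Rightarrow> 'v \<Rightarrow> 'v \<Rightarrow> bool" where
  "adj \<Gamma> x y \<longleftrightarrow> {x, y} \<in> edges \<Gamma>"

definition finite_network :: "('v, 'm) network_scheme \<Rightarrow> bool" where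
  "finite_network \<Gamma> \<longleftrightarrow>
     finite (verts \<Gamma>) \<and> card (verts \<Gamma>) \<ge> 2 \<and>
     (\<forall>e\<in>edges \<Gamma>. \<exists>x\<in>verts \<Gamma>. \<exists>y\<in>verts \<Gamma>. e = {x, y}) \<and>
     (\<forall>x\<in>verts \<Gamma>. \<forall>y\<in>verts \<Gamma>. (adj \<Gamma>)\<^sup>*\<^sup>* x y) \<and>
     (\<forall>e\<in>edges \<Gamma>. resistance \<Gamma> e \<ge> 0 \<and> inductance \<Gamma> e \<ge> 0 \<and> elastance \<Gamma> e \<ge> 0 \<and>
        resistance \<Gamma> e + inductance \<Gamma> e + elastance \<Gamma> e > 0) \<and>
     source \<Gamma> \<in> verts \<Gamma> \<and>
     ground \<Gamma> \<subseteq> verts \<Gamma> \<and> ground \<Gamma> \<noteq> {} \<and> source \<Gamma> \<notin> ground \<Gamma>"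

definition impedance :: "('v, 'm) network_scheme \<Rightarrow> complex \<Rightarrow> 'v set \<Rightarrow> complex" where
  "impedance \<Gamma> lam e =
     of_real (resistance \<Gamma> e) + of_real (inductance \<Gamma> e) * lam + of_real (elastance \<Gamma> e) / lam"

definition edge_admittance :: "('v, 'm) network_scheme \<Rightarrow> complex \<Rightarrow> 'v set \<Rightarrow> complex" where
  "edge_admittance \<Gamma> lam e = (if e \<in> edges \<Gamma> then 1 / impedance \<Gamma> lam e else 0)"

abbreviation admittance :: "('v, 'm) network_scheme \<Rightarrow> complex \<Rightarrow> 'v \<Rightarrow> 'v \<Rightarrow> complex" where
  "admittance \<Gamma> lam x y \<equiv> edge_admittance \<Gamma> lam {x, y}"

definition regular_frequencies :: "('v, 'm) network_scheme \<Rightarrow> complex set" where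
  "regular_frequencies \<Gamma> =
     {lam. lam \<noteq> 0 \<and> (\<forall>e\<in>edges \<Gamma>.
        of_real (inductance \<Gamma> e) * lam\<^sup>2 + of_real (resistance \<Gamma> e) * lam
          + of_real (elastance \<Gamma> e) \<noteq> 0)}"

definition laplacian ::
    "('v, 'm) network_scheme \<Rightarrow> complex \<Rightarrow> ('v \<Rightarrow> complex) \<Rightarrow> 'v \<Rightarrow> complex" where
  "laplacian \<Gamma> lam f x = (\<Sum>y\<in>verts \<Gamma>. (f y - f x) * admittance \<Gamma> lam x y)"

text \<open>Values of \<open>v\<close> outside \<open>verts \<Gamma>\<close> are irrelevant in all that follows.\<close>

definition dirichlet_solution ::
    "('v, 'm) network_scheme \<Rightarrow> complex \<Rightarrow> ('v \<Rightarrow> complex) \<Rightarrow> bool" where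
  "dirichlet_solution \<Gamma> lam v \<longleftrightarrow>
     (\<forall>x\<in>verts \<Gamma> - (ground \<Gamma> \<union> {source \<Gamma>}). laplacian \<Gamma> lam v x = 0) \<and>
     (\<forall>x\<in>ground \<Gamma>. v x = 0) \<and> v (source \<Gamma>) = 1"

datatype ext_complex = Finite complex | Infinite

fun ext_norm :: "ext_complex \<Rightarrow> ereal" where
  "ext_norm (Finite z) = ereal (cmod z)"
| "ext_norm Infinite = \<infinity>"

definition admittance_of ::
    "('v, 'm) network_scheme \<Rightarrow> complex \<Rightarrow> ('v \<Rightarrow> complex) \<Rightarrow> complex" where
  "admittance_of \<Gamma> lam v = (\<Sum>x\<in>verts \<Gamma>. (1 - v x) * admittance \<Gamma> lam x (source \<Gamma>))"

text \<open>The choice of the solution is immaterial, see \<open>effective_admittance_eq\<close> below.\<close>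

definition effective_admittance :: "('v, 'm) network_scheme \<Rightarrow> complex \<Rightarrow> ext_complex" where
  "effective_admittance \<Gamma> lam =
     (if \<exists>v. dirichlet_solution \<Gamma> lam v
      then Finite (admittance_of \<Gamma> lam (SOME v. dirichlet_solution \<Gamma> lam v))
      else Infinite)"

lemma green_symmetric:
  "(\<Sum>x\<in>verts \<Gamma>. laplacian \<Gamma> lam u x * v x) = (\<Sum>x\<in>verts \<Gamma>. laplacian \<Gamma> lam v x * u x)"
proof -
  let ?V = "verts \<Gamma>" and ?r = "admittance \<Gamma> lam"
  have "(\<Sum>x\<in>?V. \<Sum>y\<in>?V. u y * v x * ?r x y) = (\<Sum>x\<in>?V. \<Sum>y\<in>?V. v y * u x * ?r x y)"
    by (subst sum.swap) (simp add: insert_commute mult.commute)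
  then show ?thesis
    by (simp add: laplacian_def sum_distrib_left sum_distrib_right algebra_simps sum_subtractf)
qed

lemma admittance_of_unique:
  assumes net: "finite_network \<Gamma>"
    and u: "dirichlet_solution \<Gamma> lam u" and v: "dirichlet_solution \<Gamma> lam v"
  shows "admittance_of \<Gamma> lam u = admittance_of \<Gamma> lam v"
proof -
  let ?V = "verts \<Gamma>" and ?a = "source \<Gamma>"
  have fin: "finite ?V" and a: "?a \<in> ?V"
    using net by (auto simp: finite_network_def)
  have source_term: "(\<Sum>x\<in>?V. laplacian \<Gamma> lam f x * g x) = - admittance_of \<Gamma> lam f"
    if f: "dirichlet_solution \<Gamma> lam f" and g: "dirichlet_solution \<Gamma> lam g" for f g
  proof -
    have "(\<Sum>x\<in>?V. laplacian \<Gamma> lam f x * g x) =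
        (\<Sum>x\<in>?V. if x = ?a then laplacian \<Gamma> lam f ?a else 0)"
      using f g by (intro sum.cong) (auto simp: dirichlet_solution_def)
    also have "\<dots> = laplacian \<Gamma> lam f ?a"
      using fin a by simp
    also have "\<dots> = - admittance_of \<Gamma> lam f"
      using f by (simp add: laplacian_def admittance_of_def dirichlet_solution_def
          insert_commute algebra_simps flip: sum_negf)
    finally show ?thesis .
  qed
  show ?thesis
    using green_symmetric[of \<Gamma> lam u v] source_term[OF u v] source_term[OF v u] by simp
qed

lemma effective_admittance_eq:
  assumes "finite_network \<Gamma>" and "dirichlet_solution \<Gamma> lam v"
  shows "effective_admittance \<Gamma> lam = Finite (admittance_of \<Gamma> lam v)"
  using assms admittance_of_unique[OF assms(1) someI[of "dirichlet_solution \<Gamma> lam"] assms(2)]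
  by (auto simp: effective_admittance_def)

end

theory Submission
  imports Defs
begin

text \<open>
  Each of the three hypotheses says that the admittances, after multiplication by a unit
  \<open>c \<in> {1, -\<i>, \<i>}\<close>, lie in a sector \<open>\<epsilon> \<bar>w\<bar> \<le> Re w\<close> around the positive real axis. In such a sector
  sums cannot cancel: the modulus of \<open>\<Sum> t\<^sub>e \<rho>\<^sub>e\<close> with weights \<open>t\<^sub>e \<ge> 0\<close> is at least
  \<open>\<epsilon> \<Sum> t\<^sub>e \<bar>\<rho>\<^sub>e\<bar>\<close>. Write \<open>E(f) = 1/2 \<Sum>\<^sub>x \<Sum>\<^sub>y \<bar>f y - f x\<bar>\<^sup>2 \<bar>\<rho>\<^sub>x\<^sub>y\<bar>\<close>. Green's formula
  expresses \<open>- \<Sum>\<^sub>x \<Delta>f(x) cnj (f x)\<close> as the same sum with \<open>\<rho>\<^sub>x\<^sub>y\<close> in place of its modulus, so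
  \<open>\<epsilon> E(f) \<le> \<bar>\<Sum>\<^sub>x \<Delta>f(x) cnj (f x)\<bar>\<close> (lemma \<open>sector_energy_le\<close>). This is used twice.

  If \<open>f\<close> vanishes at the boundary and is harmonic elsewhere, the right-hand side is \<open>0\<close>; hence
  \<open>E(f) = 0\<close> and \<open>f = 0\<close> by connectedness. This uniqueness gives the existence of a
  solution: the harmonic functions vanishing on the ground solve a homogeneous system with one
  equation fewer than unknowns, so a nonzero one exists; by uniqueness it cannot vanish at the
  source, and it can be normalised there. In particular \<open>\<P> \<noteq> \<infinity>\<close>.

  If \<open>v\<close> is a solution, the right-hand side is \<open>\<bar>\<P>\<bar>\<close>, so \<open>E(v) \<le> \<bar>\<P>\<bar> / \<epsilon>\<close>. On the other
  hand, the Cauchy--Schwarz inequality applied to \<open>\<P> = \<Sum>\<^sub>x (1 - v x) \<rho>\<^sub>x\<^sub>a\<close> gives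
  \<open>\<bar>\<P>\<bar>\<^sup>2 \<le> E(v) \<Sum>\<^sub>x \<bar>\<rho>\<^sub>x\<^sub>a\<bar>\<close>. Together they yield \<open>\<bar>\<P>\<bar> \<le> (1/\<epsilon>) \<Sum>\<^sub>x \<bar>\<rho>\<^sub>x\<^sub>a\<bar>\<close>, which implies the
  claim because \<open>\<epsilon> \<le> 1\<close>.
\<close>

section \<open>Underdetermined homogeneous linear systems\<close>

text \<open>
  Gaussian elimination: a pivot in one equation removes that equation together with one unknown,
  and an equation without a pivot is vacuous.
\<close>

lemma nonzero_solution_of_underdetermined_system:
  fixes A :: "'i \<Rightarrow> 'j \<Rightarrow> 'a::field"
  assumes "finite T" "finite U" "card T < card U"
  shows "\<exists>u. (\<forall>x\<in>T. (\<Sum>y\<in>U. A x y * u y) = 0) \<and> (\<exists>y\<in>U. u y \<noteq> 0)"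
  using assms
proof (induction T arbitrary: U A rule: finite_induct)
  case empty
  then have "U \<noteq> {}" by auto
  then show ?case by (intro exI[of _ "\<lambda>_. 1"]) auto
next
  case (insert t T)
  show ?case
  proof (cases "\<forall>y\<in>U. A t y = 0")
    case True
    have "card T < card U" using insert by simp
    with insert.IH[of U A] insert.prems True show ?thesis by auto
  next
    case False
    then obtain p where p: "p \<in> U" "A t p \<noteq> 0" by auto
    define U' where "U' = U - {p}"
    define A' where "A' x y = A x y - A x p * A t y / A t p" for x y
    have U': "finite U'" "p \<notin> U'" "U = insert p U'"
      using insert.prems p by (auto simp: U'_def)
    have "card T < card U'" using insert U' by simp
    from insert.IH[OF U'(1) this, of A'] obtain u where
      u: "\<And>x. x \<in> T \<Longrightarrow> (\<Sum>y\<in>U'. A' x y * u y) = 0" "\<exists>y\<in>U'. u y \<noteq> 0" by blast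
    define s where "s = (\<Sum>y\<in>U'. A t y * u y)"
    define w where "w = u(p := - s / A t p)"
    have split: "(\<Sum>y\<in>U. A x y * w y) = (\<Sum>y\<in>U'. A x y * u y) - A x p * s / A t p" for x
    proof -
      have "(\<Sum>y\<in>U'. A x y * w y) = (\<Sum>y\<in>U'. A x y * u y)"
        using U' by (intro sum.cong) (auto simp: w_def)
      then show ?thesis using U' by (simp add: w_def)
    qed
    have "(\<Sum>y\<in>U. A x y * w y) = (\<Sum>y\<in>U'. A' x y * u y)" for x
      unfolding split by (simp add: A'_def s_def algebra_simps sum_subtractf
          sum_distrib_left sum_divide_distrib)
    moreover have "(\<Sum>y\<in>U. A t y * w y) = 0"
      unfolding split using p by (simp add: s_def)
    moreover have "\<exists>y\<in>U. w y \<noteq> 0"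
      using u(2) U' by (auto simp: w_def)
    ultimately show ?thesis using u(1) by (intro exI[of _ w]) auto
  qed
qed

section \<open>Energy and Green's formula\<close>

text \<open>Summing over ordered pairs counts every edge twice, hence the factor one half.\<close>

definition energy :: "('v, 'm) network_scheme \<Rightarrow> complex \<Rightarrow> ('v \<Rightarrow> complex) \<Rightarrow> real" where
  "energy \<Gamma> lam f =
     (\<Sum>x\<in>verts \<Gamma>. \<Sum>y\<in>verts \<Gamma>. (cmod (f y - f x))\<^sup>2 * cmod (admittance \<Gamma> lam x y)) / 2"

text \<open>
  Exchanging the two summation variables on one half of the left-hand side pairs the terms of
  \<open>(x, y)\<close> and \<open>(y, x)\<close>.
\<close>

lemma green_energy:
  "2 * (\<Sum>x\<in>verts \<Gamma>. laplacian \<Gamma> lam f x * cnj (f x)) =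
     - (\<Sum>x\<in>verts \<Gamma>. \<Sum>y\<in>verts \<Gamma>.
          of_real ((cmod (f y - f x))\<^sup>2) * admittance \<Gamma> lam x y)"
proof -
  let ?V = "verts \<Gamma>" and ?r = "admittance \<Gamma> lam"
  let ?S = "\<Sum>x\<in>?V. \<Sum>y\<in>?V. (f y - f x) * ?r x y * cnj (f x)"
  have "?S = (\<Sum>x\<in>?V. \<Sum>y\<in>?V. (f x - f y) * ?r x y * cnj (f y))"
    by (subst sum.swap) (simp add: insert_commute)
  then have "?S + ?S = (\<Sum>x\<in>?V. \<Sum>y\<in>?V.
      (f y - f x) * ?r x y * cnj (f x) + (f x - f y) * ?r x y * cnj (f y))"
    by (simp add: sum.distrib)
  also have "\<dots> = (\<Sum>x\<in>?V. \<Sum>y\<in>?V. - (of_real ((cmod (f y - f x))\<^sup>2) * ?r x y))"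
    by (intro sum.cong refl) (simp add: complex_norm_square algebra_simps
        del: of_real_power)
  finally show ?thesis
    by (simp add: laplacian_def sum_distrib_right sum_negf)
qed

definition admittances_in_sector ::
    "('v, 'm) network_scheme \<Rightarrow> complex \<Rightarrow> complex \<Rightarrow> real \<Rightarrow> bool" where
  "admittances_in_sector \<Gamma> lam c \<epsilon> \<longleftrightarrow>
     cmod c = 1 \<and>
     (\<forall>e\<in>edges \<Gamma>. \<epsilon> * cmod (edge_admittance \<Gamma> lam e) \<le> Re (c * edge_admittance \<Gamma> lam e))"

text \<open>
  The real part of \<open>c\<close> times the right-hand side of Green's formula dominates the energy term by
  term.
\<close>

lemma sector_energy_le:
  assumes sec: "admittances_in_sector \<Gamma> lam c \<epsilon>"
  shows "\<epsilon> * energy \<Gamma> lam f \<le> cmod (\<Sum>x\<in>verts \<Gamma>. laplacian \<Gamma> lam f x * cnj (f x))"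
proof -
  let ?V = "verts \<Gamma>" and ?r = "admittance \<Gamma> lam"
  let ?d = "\<lambda>x y. (cmod (f y - f x))\<^sup>2"
  let ?G = "\<Sum>x\<in>?V. laplacian \<Gamma> lam f x * cnj (f x)"
  have r: "\<epsilon> * cmod (?r x y) \<le> Re (c * ?r x y)" for x y
    using sec by (cases "{x, y} \<in> edges \<Gamma>")
      (auto simp: admittances_in_sector_def edge_admittance_def)
  have "2 * (\<epsilon> * energy \<Gamma> lam f) = (\<Sum>x\<in>?V. \<Sum>y\<in>?V. ?d x y * (\<epsilon> * cmod (?r x y)))"
    by (simp add: energy_def sum_distrib_left mult_ac)
  also have "\<dots> \<le> (\<Sum>x\<in>?V. \<Sum>y\<in>?V. ?d x y * Re (c * ?r x y))"
    using r by (intro sum_mono mult_left_mono) auto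
  also have "\<dots> = (\<Sum>x\<in>?V. \<Sum>y\<in>?V. Re (c * (of_real (?d x y) * ?r x y)))"
    by (intro sum.cong refl) (simp add: algebra_simps del: of_real_power)
  also have "\<dots> = Re (c * (\<Sum>x\<in>?V. \<Sum>y\<in>?V. of_real (?d x y) * ?r x y))"
    by (simp only: sum_distrib_left Re_sum)
  also have "\<dots> = Re (c * - (2 * ?G))"
    by (simp only: green_energy minus_minus)
  also have "\<dots> \<le> cmod (c * - (2 * ?G))"
    by (rule complex_Re_le_cmod)
  also have "\<dots> = 2 * cmod ?G"
    using sec by (simp add: admittances_in_sector_def norm_mult)
  finally show ?thesis by simp
qed

text \<open>The boundary terms at the ground vanish with \<open>f\<close>, leaving only the source.\<close>

lemma harmonic_source_term:
  assumes net: "finite_network \<Gamma>"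
    and harm: "\<And>x. x \<in> verts \<Gamma> - (ground \<Gamma> \<union> {source \<Gamma>}) \<Longrightarrow> laplacian \<Gamma> lam f x = 0"
    and zero: "\<And>x. x \<in> ground \<Gamma> \<Longrightarrow> f x = 0"
  shows "(\<Sum>x\<in>verts \<Gamma>. laplacian \<Gamma> lam f x * cnj (f x)) =
           laplacian \<Gamma> lam f (source \<Gamma>) * cnj (f (source \<Gamma>))"
proof -
  have "(\<Sum>x\<in>verts \<Gamma>. laplacian \<Gamma> lam f x * cnj (f x)) =
      (\<Sum>x\<in>verts \<Gamma>. if x = source \<Gamma>
         then laplacian \<Gamma> lam f (source \<Gamma>) * cnj (f (source \<Gamma>)) else 0)"
    using harm zero by (intro sum.cong) auto
  then show ?thesis using net by (simp add: finite_network_def)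
qed

section \<open>Solvability of the Dirichlet problem\<close>

lemma edge_admittance_nonzero:
  assumes "lam \<in> regular_frequencies \<Gamma>" and "e \<in> edges \<Gamma>"
  shows "edge_admittance \<Gamma> lam e \<noteq> 0"
proof -
  have "lam * impedance \<Gamma> lam e = of_real (inductance \<Gamma> e) * lam\<^sup>2
      + of_real (resistance \<Gamma> e) * lam + of_real (elastance \<Gamma> e)"
    using assms by (simp add: impedance_def regular_frequencies_def field_simps power2_eq_square)
  then show ?thesis
    using assms by (auto simp: edge_admittance_def regular_frequencies_def)
qed

lemma zero_energy_imp_constant:
  assumes net: "finite_network \<Gamma>" and reg: "lam \<in> regular_frequencies \<Gamma>"
    and en: "energy \<Gamma> lam f \<le> 0"
    and x: "x \<in> verts \<Gamma>" and y: "y \<in> verts \<Gamma>"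
  shows "f x = f y"
proof -
  let ?V = "verts \<Gamma>"
  let ?d = "\<lambda>x y. (cmod (f y - f x))\<^sup>2 * cmod (admittance \<Gamma> lam x y)"
  have fin: "finite ?V" using net by (simp add: finite_network_def)
  have "0 \<le> (\<Sum>x\<in>?V. \<Sum>y\<in>?V. ?d x y)" by (intro sum_nonneg) simp
  with en have "(\<Sum>x\<in>?V. \<Sum>y\<in>?V. ?d x y) = 0" by (simp add: energy_def)
  then have d0: "?d x y = 0" if "x \<in> ?V" "y \<in> ?V" for x y
    using fin that by (simp add: sum_nonneg_eq_0_iff sum_nonneg)
  have step: "f x = f y" if "adj \<Gamma> x y" for x y
  proof -
    have "x \<in> ?V" "y \<in> ?V"
      using that net by (auto simp: finite_network_def adj_def doubleton_eq_iff)
    then show ?thesis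
      using d0[of x y] edge_admittance_nonzero[OF reg] that by (auto simp: adj_def)
  qed
  have "(adj \<Gamma>)\<^sup>*\<^sup>* x y" using net x y by (simp add: finite_network_def)
  then show ?thesis by induction (auto dest: step)
qed

lemma dirichlet_unique:
  assumes net: "finite_network \<Gamma>" and reg: "lam \<in> regular_frequencies \<Gamma>"
    and sec: "admittances_in_sector \<Gamma> lam c \<epsilon>" and eps: "\<epsilon> > 0"
    and harm: "\<And>x. x \<in> verts \<Gamma> - (ground \<Gamma> \<union> {source \<Gamma>}) \<Longrightarrow> laplacian \<Gamma> lam f x = 0"
    and zero: "\<And>x. x \<in> ground \<Gamma> \<Longrightarrow> f x = 0" "f (source \<Gamma>) = 0"
    and x: "x \<in> verts \<Gamma>"
  shows "f x = 0"
proof -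
  have "\<epsilon> * energy \<Gamma> lam f \<le> 0"
    using sector_energy_le[OF sec, of f] harmonic_source_term[OF net harm zero(1)] zero(2) by simp
  then have "energy \<Gamma> lam f \<le> 0"
    using eps by (simp add: mult_le_0_iff)
  moreover have "source \<Gamma> \<in> verts \<Gamma>" using net by (simp add: finite_network_def)
  ultimately show ?thesis
    using zero_energy_imp_constant[OF net reg] x zero(2) by metis
qed

text \<open>
  The unknowns are the values off the ground, the equations are harmonicity off the ground and the
  source.
\<close>

lemma dirichlet_solution_exists:
  assumes net: "finite_network \<Gamma>" and reg: "lam \<in> regular_frequencies \<Gamma>"
    and sec: "admittances_in_sector \<Gamma> lam c \<epsilon>" and eps: "\<epsilon> > 0"
  shows "\<exists>v. dirichlet_solution \<Gamma> lam v"
proof -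
  let ?V = "verts \<Gamma>" and ?B = "ground \<Gamma>" and ?a = "source \<Gamma>" and ?r = "admittance \<Gamma> lam"
  define U where "U = ?V - ?B"
  define A where "A x y = ?r x y - (if y = x then \<Sum>z\<in>?V. ?r x z else 0)" for x y
  have fin: "finite ?V" "finite U" and a: "?a \<in> U"
    using net by (auto simp: finite_network_def U_def)
  have "card (U - {?a}) < card U" using fin(2) a by (rule card_Diff1_less)
  then obtain u where u: "\<And>x. x \<in> U - {?a} \<Longrightarrow> (\<Sum>y\<in>U. A x y * u y) = 0"
    and nz: "\<exists>y\<in>U. u y \<noteq> 0"
    using nonzero_solution_of_underdetermined_system[of "U - {?a}" U A] fin by auto
  define w where "w x = (if x \<in> U then u x else 0)" for x
  have harm: "laplacian \<Gamma> lam w x = 0" if x: "x \<in> ?V - (?B \<union> {?a})" for x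
  proof -
    have xU: "x \<in> U - {?a}" using x by (auto simp: U_def)
    have "laplacian \<Gamma> lam w x = (\<Sum>y\<in>?V. w y * ?r x y) - w x * (\<Sum>y\<in>?V. ?r x y)"
      by (simp add: laplacian_def left_diff_distrib sum_subtractf sum_distrib_left)
    also have "(\<Sum>y\<in>?V. w y * ?r x y) = (\<Sum>y\<in>U. ?r x y * u y)"
      using fin by (intro sum.mono_neutral_cong_right) (auto simp: w_def U_def)
    also have "\<dots> - w x * (\<Sum>y\<in>?V. ?r x y) =
        (\<Sum>y\<in>U. ?r x y * u y) - (\<Sum>y\<in>U. if y = x then (\<Sum>z\<in>?V. ?r x z) * u x else 0)"
      using fin xU by (simp add: w_def)
    also have "\<dots> = (\<Sum>y\<in>U. A x y * u y)"
      by (auto simp: A_def left_diff_distrib simp flip: sum_subtractf intro!: sum.cong)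
    finally show ?thesis using u[OF xU] by simp
  qed
  have ground: "w x = 0" if "x \<in> ?B" for x using that by (simp add: w_def U_def)
  have "w ?a \<noteq> 0"
  proof
    assume "w ?a = 0"
    then have "w x = 0" if "x \<in> ?V" for x
      using dirichlet_unique[OF net reg sec eps harm ground _ that] by blast
    moreover obtain y where "y \<in> U" "u y \<noteq> 0" using nz by blast
    moreover from this have "w y \<noteq> 0" "y \<in> ?V" by (simp_all add: w_def U_def)
    ultimately show False by blast
  qed
  moreover have "laplacian \<Gamma> lam (\<lambda>x. w x / w ?a) x = laplacian \<Gamma> lam w x / w ?a" for x
    by (simp add: laplacian_def sum_divide_distrib diff_divide_distrib left_diff_distrib)
  ultimately have "dirichlet_solution \<Gamma> lam (\<lambda>x. w x / w ?a)"
    using harm ground by (simp add: dirichlet_solution_def)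
  then show ?thesis by blast
qed

section \<open>The bound on the effective admittance\<close>

text \<open>
  Each vertex \<open>x\<close> enters the double sum \<open>2 E(f)\<close> through both ordered pairs \<open>(x, a)\<close> and
  \<open>(a, x)\<close>, and these are distinct unless the term is zero.
\<close>

lemma star_energy_le:
  assumes fin: "finite (verts \<Gamma>)" and a: "a \<in> verts \<Gamma>"
  shows "(\<Sum>x\<in>verts \<Gamma>. (cmod (f a - f x))\<^sup>2 * cmod (admittance \<Gamma> lam x a)) \<le> energy \<Gamma> lam f"
proof -
  let ?V = "verts \<Gamma>" and ?W = "verts \<Gamma> - {a}"
  let ?d = "\<lambda>x y. (cmod (f y - f x))\<^sup>2 * cmod (admittance \<Gamma> lam x y)"
  have sym: "?d x y = ?d y x" for x y by (simp add: norm_minus_commute insert_commute)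
  have daa: "?d a a = 0" by simp
  have star: "(\<Sum>x\<in>?V. ?d x a) = (\<Sum>x\<in>?W. ?d x a)"
    using sum.remove[OF fin a, of "\<lambda>x. ?d x a"] daa by simp
  have "(\<Sum>x\<in>?W. ?d x a) \<le> (\<Sum>x\<in>?W. \<Sum>y\<in>?V. ?d x y)"
    using fin a by (intro sum_mono member_le_sum) auto
  moreover have "(\<Sum>y\<in>?V. ?d a y) = (\<Sum>x\<in>?V. ?d x a)"
    by (intro sum.cong refl sym)
  ultimately have "2 * (\<Sum>x\<in>?V. ?d x a) \<le> (\<Sum>y\<in>?V. ?d a y) + (\<Sum>x\<in>?W. \<Sum>y\<in>?V. ?d x y)"
    using star by linarith
  also have "\<dots> = (\<Sum>x\<in>?V. \<Sum>y\<in>?V. ?d x y)"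
    by (rule sum.remove[OF fin a, symmetric])
  finally show ?thesis by (simp add: energy_def)
qed

text \<open>The Cauchy--Schwarz inequality with weights \<open>\<bar>\<rho>\<^sub>x\<^sub>a\<bar>\<close>.\<close>

lemma admittance_of_square_le:
  assumes net: "finite_network \<Gamma>" and v: "v (source \<Gamma>) = 1"
  shows "(cmod (admittance_of \<Gamma> lam v))\<^sup>2 \<le>
           energy \<Gamma> lam v * (\<Sum>x\<in>verts \<Gamma>. cmod (admittance \<Gamma> lam x (source \<Gamma>)))"
proof -
  let ?V = "verts \<Gamma>" and ?a = "source \<Gamma>"
  let ?r = "\<lambda>x. cmod (admittance \<Gamma> lam x ?a)"
  have fin: "finite ?V" "?a \<in> ?V" using net by (auto simp: finite_network_def)
  have "cmod (admittance_of \<Gamma> lam v) \<le> (\<Sum>x\<in>?V. cmod (1 - v x) * ?r x)"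
    unfolding admittance_of_def by (rule order_trans[OF norm_sum]) (simp add: norm_mult)
  also have "\<dots> = (\<Sum>x\<in>?V. (cmod (1 - v x) * sqrt (?r x)) * sqrt (?r x))"
    by (simp add: mult.assoc)
  finally have "(cmod (admittance_of \<Gamma> lam v))\<^sup>2 \<le>
      (\<Sum>x\<in>?V. (cmod (1 - v x) * sqrt (?r x)) * sqrt (?r x))\<^sup>2"
    by (intro power_mono) auto
  also have "\<dots> \<le> (\<Sum>x\<in>?V. (cmod (1 - v x) * sqrt (?r x))\<^sup>2) * (\<Sum>x\<in>?V. (sqrt (?r x))\<^sup>2)"
    by (rule Cauchy_Schwarz_ineq_sum)
  also have "\<dots> = (\<Sum>x\<in>?V. (cmod (v ?a - v x))\<^sup>2 * ?r x) * (\<Sum>x\<in>?V. ?r x)"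
    by (simp add: power_mult_distrib v)
  also have "\<dots> \<le> energy \<Gamma> lam v * (\<Sum>x\<in>?V. ?r x)"
    by (intro mult_right_mono star_energy_le fin sum_nonneg) auto
  finally show ?thesis .
qed

lemma cmod_admittance_of_le:
  assumes net: "finite_network \<Gamma>" and sec: "admittances_in_sector \<Gamma> lam c \<epsilon>" and eps: "\<epsilon> > 0"
    and sol: "dirichlet_solution \<Gamma> lam v"
  shows "cmod (admittance_of \<Gamma> lam v) \<le>
           1 / \<epsilon> * (\<Sum>x\<in>verts \<Gamma>. cmod (admittance \<Gamma> lam x (source \<Gamma>)))"
proof -
  let ?P = "cmod (admittance_of \<Gamma> lam v)" and ?a = "source \<Gamma>"
  define S where "S = (\<Sum>x\<in>verts \<Gamma>. cmod (admittance \<Gamma> lam x ?a))"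
  have S: "0 \<le> S" by (simp add: S_def sum_nonneg)
  have va: "v ?a = 1" using sol by (simp add: dirichlet_solution_def)
  have "laplacian \<Gamma> lam v ?a = - admittance_of \<Gamma> lam v"
    by (simp add: laplacian_def admittance_of_def va insert_commute algebra_simps flip: sum_negf)
  moreover have "(\<Sum>x\<in>verts \<Gamma>. laplacian \<Gamma> lam v x * cnj (v x)) =
      laplacian \<Gamma> lam v ?a * cnj (v ?a)"
    using sol by (intro harmonic_source_term[OF net]) (auto simp: dirichlet_solution_def)
  ultimately have "\<epsilon> * energy \<Gamma> lam v \<le> ?P"
    using sector_energy_le[OF sec, of v] va by simp
  then have "\<epsilon> * energy \<Gamma> lam v * S \<le> ?P * S" by (rule mult_right_mono) (rule S)
  moreover have "\<epsilon> * ?P\<^sup>2 \<le> \<epsilon> * (energy \<Gamma> lam v * S)"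
    using admittance_of_square_le[where v = v, OF net va] eps
    by (intro mult_left_mono) (auto simp: S_def)
  ultimately have "?P * (\<epsilon> * ?P) \<le> ?P * S" by (simp add: power2_eq_square mult_ac)
  then have "\<epsilon> * ?P \<le> S"
    using S by (cases "?P = 0") (simp_all add: mult_le_cancel_left)
  then show ?thesis using eps by (simp add: field_simps S_def)
qed

lemma finite_edges: "finite_network \<Gamma> \<Longrightarrow> finite (edges \<Gamma>)"
  by (rule finite_subset[of _ "Pow (verts \<Gamma>)"]) (fastforce simp: finite_network_def)+

lemma edges_nonempty:
  assumes net: "finite_network \<Gamma>"
  shows "edges \<Gamma> \<noteq> {}"
proof -
  obtain b where "b \<in> verts \<Gamma>" "b \<noteq> source \<Gamma>"
    using net unfolding finite_network_def by blast
  then have "(adj \<Gamma>)\<^sup>*\<^sup>* (source \<Gamma>) b" "source \<Gamma> \<noteq> b"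
    using net by (auto simp: finite_network_def)
  then show ?thesis
    by (auto elim: converse_rtranclpE simp: adj_def)
qed

lemma sector_of_INF_le:
  assumes net: "finite_network \<Gamma>" and reg: "lam \<in> regular_frequencies \<Gamma>" and c: "cmod c = 1"
    and le: "\<epsilon> \<le> (INF e\<in>edges \<Gamma>.
      Re (c * edge_admittance \<Gamma> lam e) / cmod (edge_admittance \<Gamma> lam e))"
  shows "admittances_in_sector \<Gamma> lam c \<epsilon>"
  unfolding admittances_in_sector_def
proof (intro conjI ballI c)
  let ?q = "\<lambda>e. Re (c * edge_admittance \<Gamma> lam e) / cmod (edge_admittance \<Gamma> lam e)"
  fix e assume e: "e \<in> edges \<Gamma>"
  have "\<epsilon> \<le> ?q e"
    using le by (rule order_trans) (intro cINF_lower e bdd_below_finite finite_imageI finite_edges net)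
  then show "\<epsilon> * cmod (edge_admittance \<Gamma> lam e) \<le> Re (c * edge_admittance \<Gamma> lam e)"
    using edge_admittance_nonzero[OF reg e] by (simp add: le_divide_eq)
qed

lemma sector_le_1:
  assumes net: "finite_network \<Gamma>" and reg: "lam \<in> regular_frequencies \<Gamma>"
    and sec: "admittances_in_sector \<Gamma> lam c \<epsilon>"
  shows "\<epsilon> \<le> 1"
proof -
  obtain e where e: "e \<in> edges \<Gamma>" using edges_nonempty[OF net] by auto
  let ?r = "edge_admittance \<Gamma> lam e"
  have "\<epsilon> * cmod ?r \<le> Re (c * ?r)" using sec e by (simp add: admittances_in_sector_def)
  also have "\<dots> \<le> cmod (c * ?r)" by (rule complex_Re_le_cmod)
  also have "\<dots> = cmod ?r" using sec by (simp add: admittances_in_sector_def norm_mult)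
  finally show ?thesis using edge_admittance_nonzero[OF reg e] by simp
qed

theorem theorem10:
  fixes \<Gamma> :: "'v network" and lam :: complex and \<epsilon> :: real
  assumes "finite_network \<Gamma>"
    and "lam \<in> regular_frequencies \<Gamma>"
    and "\<epsilon> > 0"
    and "(INF e\<in>edges \<Gamma>. Re (edge_admittance \<Gamma> lam e) / cmod (edge_admittance \<Gamma> lam e)) \<ge> \<epsilon> \<or>
         (INF e\<in>edges \<Gamma>. Im (edge_admittance \<Gamma> lam e) / cmod (edge_admittance \<Gamma> lam e)) \<ge> \<epsilon> \<or>
         (INF e\<in>edges \<Gamma>. - Im (edge_admittance \<Gamma> lam e) / cmod (edge_admittance \<Gamma> lam e)) \<ge> \<epsilon>"
  shows "ext_norm (effective_admittance \<Gamma> lam)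
           \<le> ereal (1 / \<epsilon>\<^sup>2 * (\<Sum>x\<in>{x \<in> verts \<Gamma>. adj \<Gamma> x (source \<Gamma>)}.
                                   cmod (admittance \<Gamma> lam x (source \<Gamma>))))"
proof -
  note net = assms(1) and reg = assms(2) and eps = assms(3)
  \<comment> \<open>\<open>Im w = Re (- \<i> w)\<close> and \<open>- Im w = Re (\<i> w)\<close>.\<close>
  obtain c where sec: "admittances_in_sector \<Gamma> lam c \<epsilon>"
    using assms(4) sector_of_INF_le[OF net reg, of 1 \<epsilon>]
      sector_of_INF_le[OF net reg, of "-\<i>" \<epsilon>] sector_of_INF_le[OF net reg, of "\<i>" \<epsilon>]
    by auto
  obtain v where v: "dirichlet_solution \<Gamma> lam v"
    using dirichlet_solution_exists[OF net reg sec eps] by auto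
  define S where "S = (\<Sum>x\<in>verts \<Gamma>. cmod (admittance \<Gamma> lam x (source \<Gamma>)))"
  have S_adj: "S = (\<Sum>x\<in>{x \<in> verts \<Gamma>. adj \<Gamma> x (source \<Gamma>)}.
      cmod (admittance \<Gamma> lam x (source \<Gamma>)))"
    unfolding S_def using net
    by (intro sum.mono_neutral_right) (auto simp: finite_network_def adj_def edge_admittance_def)
  have "cmod (admittance_of \<Gamma> lam v) \<le> 1 / \<epsilon> * S"
    using cmod_admittance_of_le[OF net sec eps v] by (simp add: S_def)
  also have "\<dots> \<le> 1 / \<epsilon>\<^sup>2 * S"
  proof (intro mult_right_mono divide_left_mono)
    show "\<epsilon>\<^sup>2 \<le> \<epsilon>"
      using sector_le_1[OF net reg sec] eps by (simp add: power2_eq_square mult_left_le)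
  qed (use eps in \<open>auto simp: S_def sum_nonneg\<close>)
  finally show ?thesis
    using effective_admittance_eq[OF net v] S_adj by simp
qed

end
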